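(* Let $\Phi$ be the sequence of $kd$ vectors consisting of $k\ge3$ mutually unbiased bases $\mathcal{B}_1,\ldots,\mathcal{B}_k$ for $\mathbb{C}^d$. Then $\Phi$ is determined up to projective unitary equivalence by its $3$-products; that is, writing $\Phi=(v_j)_{j\in J}$, if $\Psi=(w_j)_{j\in J}$ is any sequence of vectors in a complex inner product space with $$\langle v_j,v_k\rangle\langle v_k,v_\ell\rangle\langle v_\ell,v_j\rangle=\langle w_j,w_k\rangle\langle w_k,w_\ell\rangle\langle w_\ell,w_j\rangle\qquad\text{for all } j,k,\ell\in J$$ (indices not necessarily distinct), then $\Phi$ and $\Psi$ are projectively unitarily equivalent.
   Context: Inner products are linear in the first variable. A family of orthonormal bases $\mathcal{B}_1,\ldots,\mathcal{B}_k$ for $\mathbb{C}^d$ is mutually unbiased (MUBs) if $|\langle v,w\rangle|^2=\frac1d$ for all $v\in\mathcal{B}_r$, $w\in\mathcal{B}_s$, $r\ne s$. Let $(v_j)$ and $(w_j)$ be finite sequences with the same index set in complex inner product spaces, and let $\mathcal{H}_1=\mathrm{span}\{v_j\}$, $\mathcal{H}_2=\mathrm{span}\{w_j\}$. They are projectively unitarily equivalent if there are a unitary map (surjective linear isometry) $U:\mathcal{H}_1\to\mathcal{H}_2$ and scalars $c_j\in\mathbb{C}$ with $|c_j|=1$ such that $w_j=c_jUv_j$ for all $j$. The $3$-products of $(v_j)$ are the numbers $\langle v_j,v_k\rangle\langle v_k,v_\ell\rangle\langle v_\ell,v_j\rangle$. *)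

theory Defs
  imports "HOL-Analysis.Analysis"
begin

locale complex_inner_space = vector_space scale
  for scale :: "complex \<Rightarrow> 'a::ab_group_add \<Rightarrow> 'a" +
  fixes ip :: "'a \<Rightarrow> 'a \<Rightarrow> complex"
  assumes ip_add_left: "ip (x + y) z = ip x z + ip y z"
    and ip_scale_left: "ip (scale c x) y = c * ip x y"
    and ip_cnj_commute: "ip x y = cnj (ip y x)"
    and ip_self_pos: "x \<noteq> 0 \<Longrightarrow> 0 < Re (ip x x)"

text \<open>The standard inner product on \<open>complex ^ 'd\<close>, linear in the first variable.
  The library's \<open>inner\<close> on this type is only the real part of it.\<close>

definition cinner :: "complex ^ 'd \<Rightarrow> complex ^ 'd \<Rightarrow> complex" where
  "cinner x y = (\<Sum>i\<in>UNIV. x $ i * cnj (y $ i))"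

lemma complex_inner_space_cinner:
  "complex_inner_space vector_scalar_mult (cinner :: complex ^ 'd \<Rightarrow> complex ^ 'd \<Rightarrow> complex)"
proof unfold_locales
  fix x y z :: "complex ^ 'd" and c :: complex
  show "cinner (x + y) z = cinner x z + cinner y z"
    by (simp add: cinner_def distrib_right sum.distrib)
  show "cinner (c *s x) y = c * cinner x y"
    by (simp add: cinner_def sum_distrib_left mult.assoc)
  show "cinner x y = cnj (cinner y x)"
    by (simp add: cinner_def mult.commute)
  assume "x \<noteq> 0"
  then obtain i where i: "x $ i \<noteq> 0"
    by (auto simp: vec_eq_iff)
  have "Re (cinner x x) = (\<Sum>i\<in>UNIV. (cmod (x $ i))\<^sup>2)"
    by (simp add: cinner_def complex_mult_cnj cmod_power2)
  also have "\<dots> > 0"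
    using i by (intro sum_pos2[of _ i]) auto
  finally show "0 < Re (cinner x x)" .
qed

definition ip_norm :: "('a \<Rightarrow> 'a \<Rightarrow> complex) \<Rightarrow> 'a \<Rightarrow> real" where
  "ip_norm ip x = sqrt (Re (ip x x))"

text \<open>Bases are indexed families rather than sets: for \<open>d = 1\<close> different mutually unbiased
  bases may have vectors in common, which must be listed repeatedly.\<close>

definition orthonormal_basis :: "'i set \<Rightarrow> ('i \<Rightarrow> complex ^ 'd) \<Rightarrow> bool" where
  "orthonormal_basis I b \<longleftrightarrow>
     (\<forall>i\<in>I. \<forall>j\<in>I. cinner (b i) (b j) = (if i = j then 1 else 0)) \<and>
     vec.span (b ` I) = UNIV"

definition mutually_unbiased_bases :: "nat \<Rightarrow> (nat \<Rightarrow> nat \<Rightarrow> complex ^ 'd) \<Rightarrow> bool" where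
  "mutually_unbiased_bases k B \<longleftrightarrow>
     (\<forall>r\<in>{1..k}. orthonormal_basis {1..CARD('d)} (B r)) \<and>
     (\<forall>r\<in>{1..k}. \<forall>s\<in>{1..k}. r \<noteq> s \<longrightarrow>
        (\<forall>i\<in>{1..CARD('d)}. \<forall>j\<in>{1..CARD('d)}.
           (cmod (cinner (B r i) (B s j)))\<^sup>2 = 1 / real CARD('d)))"

definition triple_product ::
  "('a \<Rightarrow> 'a \<Rightarrow> complex) \<Rightarrow> ('j \<Rightarrow> 'a) \<Rightarrow> 'j \<Rightarrow> 'j \<Rightarrow> 'j \<Rightarrow> complex" where
  "triple_product ip v j k l = ip (v j) (v k) * ip (v k) (v l) * ip (v l) (v j)"

text \<open>Surjective linear isometries between subspaces \<open>S\<close> and \<open>T\<close>; the values of \<open>U\<close>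
  outside \<open>S\<close> are irrelevant.\<close>

definition unitary_map ::
  "(complex \<Rightarrow> 'a::ab_group_add \<Rightarrow> 'a) \<Rightarrow> ('a \<Rightarrow> 'a \<Rightarrow> complex) \<Rightarrow> 'a set \<Rightarrow>
   (complex \<Rightarrow> 'b::ab_group_add \<Rightarrow> 'b) \<Rightarrow> ('b \<Rightarrow> 'b \<Rightarrow> complex) \<Rightarrow> 'b set \<Rightarrow>
   ('a \<Rightarrow> 'b) \<Rightarrow> bool" where
  "unitary_map s1 ip1 S s2 ip2 T U \<longleftrightarrow>
     (\<forall>x\<in>S. \<forall>y\<in>S. U (x + y) = U x + U y) \<and>
     (\<forall>c. \<forall>x\<in>S. U (s1 c x) = s2 c (U x)) \<and>
     (\<forall>x\<in>S. ip_norm ip2 (U x) = ip_norm ip1 x) \<and>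
     U ` S = T"

definition proj_unitarily_equivalent ::
  "(complex \<Rightarrow> 'a::ab_group_add \<Rightarrow> 'a) \<Rightarrow> ('a \<Rightarrow> 'a \<Rightarrow> complex) \<Rightarrow>
   (complex \<Rightarrow> 'b::ab_group_add \<Rightarrow> 'b) \<Rightarrow> ('b \<Rightarrow> 'b \<Rightarrow> complex) \<Rightarrow>
   'j set \<Rightarrow> ('j \<Rightarrow> 'a) \<Rightarrow> ('j \<Rightarrow> 'b) \<Rightarrow> bool" where
  "proj_unitarily_equivalent s1 ip1 s2 ip2 J v w \<longleftrightarrow>
     (\<exists>U c. unitary_map s1 ip1 (module.span s1 (v ` J)) s2 ip2 (module.span s2 (w ` J)) U \<and>
        (\<forall>j\<in>J. cmod (c j) = 1 \<and> w j = s2 (c j) (U (v j))))"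

end

(* The relative phases <w_j,w_l>/<v_j,v_l> live on the edges of the complete k-partite graph
   whose parts are the bases, and equality of the 3-products says that their product around
   every triangle is 1.  As k >= 3, every cycle of this graph is a sum of triangles, so the
   phases are of the form c_j/c_l.  Rescaling the w_j by the c_j turns the Gram matrix of (w_j)
   into that of (v_j), and families with equal Gram matrices are unitarily equivalent. *)

theory Submission
  imports Defs
begin

context complex_inner_space
begin

lemma ip_zero_left [simp]: "ip 0 y = 0"
  using ip_scale_left[of 0 0 y] by simp

lemma ip_add_right: "ip x (y + z) = ip x y + ip x z"
  by (metis ip_add_left ip_cnj_commute complex_cnj_add)

lemma ip_scale_right: "ip x (scale c y) = cnj c * ip x y"
  by (metis ip_scale_left ip_cnj_commute complex_cnj_mult)

lemma ip_zero_right [simp]: "ip x 0 = 0"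
  by (metis ip_zero_left ip_cnj_commute complex_cnj_zero)

lemma ip_sum_left: "ip (\<Sum>j\<in>J. f j) y = (\<Sum>j\<in>J. ip (f j) y)"
  by (induction J rule: infinite_finite_induct) (auto simp: ip_add_left)

lemma ip_sum_right: "ip x (\<Sum>j\<in>J. f j) = (\<Sum>j\<in>J. ip x (f j))"
  by (induction J rule: infinite_finite_induct) (auto simp: ip_add_right)

lemma ip_linear_combination:
  "ip (\<Sum>j\<in>J. scale (f j) (x j)) (\<Sum>l\<in>J. scale (g l) (x l)) =
     (\<Sum>j\<in>J. \<Sum>l\<in>J. f j * cnj (g l) * ip (x j) (x l))"
  by (simp only: ip_sum_left) (simp add: ip_sum_right ip_scale_left ip_scale_right sum_distrib_left mult_ac)

lemma ip_self_real: "ip x x = complex_of_real (Re (ip x x))"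
  using ip_cnj_commute[of x x] by (simp add: complex_eq_iff)

lemma ip_self_nonneg: "Re (ip x x) \<ge> 0"
  using ip_self_pos[of x] by (cases "x = 0") auto

lemma ip_self_eq_0_iff: "ip x x = 0 \<longleftrightarrow> x = 0"
  using ip_self_pos[of x] by fastforce

lemma ip_mult_commuted: "ip x y * ip y x = complex_of_real ((cmod (ip x y))\<^sup>2)"
  by (metis ip_cnj_commute complex_norm_square)

text \<open>Coefficients are indexed by \<open>J\<close> rather than by the vectors themselves, so
  that repetitions in the family are allowed and one coefficient function can be applied to two
  families at once.\<close>

lemma span_image_eq_linear_combinations:
  assumes "finite J"
  shows "span (v ` J) = range (\<lambda>f. \<Sum>j\<in>J. scale (f j) (v j))"
proof
  show "range (\<lambda>f. \<Sum>j\<in>J. scale (f j) (v j)) \<subseteq> span (v ` J)"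
    by (auto intro!: span_sum span_scale intro: span_base)
  show "span (v ` J) \<subseteq> range (\<lambda>f. \<Sum>j\<in>J. scale (f j) (v j))"
  proof (rule span_minimal)
    show "v ` J \<subseteq> range (\<lambda>f. \<Sum>j\<in>J. scale (f j) (v j))"
    proof
      fix x assume "x \<in> v ` J"
      then obtain i where i: "i \<in> J" "x = v i" by auto
      have "(\<Sum>j\<in>J. scale (if j = i then 1 else 0) (v j)) = (\<Sum>j\<in>J. if j = i then v j else 0)"
        by (rule sum.cong) auto
      then have "x = (\<Sum>j\<in>J. scale (if j = i then 1 else 0) (v j))"
        using assms i by simp
      then show "x \<in> range (\<lambda>f. \<Sum>j\<in>J. scale (f j) (v j))"
        by (rule range_eqI[of _ _ "\<lambda>j. if j = i then 1 else 0"])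
    qed
    show "subspace (range (\<lambda>f. \<Sum>j\<in>J. scale (f j) (v j)))"
    proof (rule subspaceI)
      show "0 \<in> range (\<lambda>f. \<Sum>j\<in>J. scale (f j) (v j))"
        by (rule range_eqI[of _ _ "\<lambda>_. 0"]) simp
      fix x y c
      assume "x \<in> range (\<lambda>f. \<Sum>j\<in>J. scale (f j) (v j))"
      then obtain f where f: "x = (\<Sum>j\<in>J. scale (f j) (v j))" by auto
      show "scale c x \<in> range (\<lambda>f. \<Sum>j\<in>J. scale (f j) (v j))"
        unfolding f by (rule range_eqI[of _ _ "\<lambda>j. c * f j"]) (simp add: scale_sum_right)
      assume "y \<in> range (\<lambda>f. \<Sum>j\<in>J. scale (f j) (v j))"
      then obtain g where g: "y = (\<Sum>j\<in>J. scale (g j) (v j))" by auto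
      show "x + y \<in> range (\<lambda>f. \<Sum>j\<in>J. scale (f j) (v j))"
        unfolding f g
        by (rule range_eqI[of _ _ "\<lambda>j. f j + g j"]) (simp add: scale_left_distrib sum.distrib)
    qed
  qed
qed

end

text \<open>The norm of a linear combination depends only on its coefficients and the Gram matrix.
  Hence sending the combination of the \<open>v j\<close> with coefficients \<open>f\<close> to the
  combination of the \<open>u j\<close> with the same coefficients is well defined and
  isometric.\<close>

lemma unitary_map_of_gram_eq:
  assumes "complex_inner_space s1 ip1" and "complex_inner_space s2 ip2" and "finite J"
    and gram: "\<And>j l. j \<in> J \<Longrightarrow> l \<in> J \<Longrightarrow> ip2 (u j) (u l) = ip1 (v j) (v l)"
  obtains U where "unitary_map s1 ip1 (module.span s1 (v ` J)) s2 ip2 (module.span s2 (u ` J)) U"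
    and "\<And>j. j \<in> J \<Longrightarrow> U (v j) = u j"
proof -
  interpret V: complex_inner_space s1 ip1 by fact
  interpret W: complex_inner_space s2 ip2 by fact
  define L where "L f = (\<Sum>j\<in>J. s1 (f j) (v j))" for f
  define M where "M f = (\<Sum>j\<in>J. s2 (f j) (u j))" for f
  have ip: "ip2 (M f) (M f) = ip1 (L f) (L f)" for f
    by (simp add: L_def M_def V.ip_linear_combination W.ip_linear_combination gram)
  have L_add: "L (\<lambda>j. f j + g j) = L f + L g" for f g
    by (simp add: L_def V.scale_left_distrib sum.distrib)
  have M_add: "M (\<lambda>j. f j + g j) = M f + M g" for f g
    by (simp add: M_def W.scale_left_distrib sum.distrib)
  have L_scale: "L (\<lambda>j. c * f j) = s1 c (L f)" for c f
    by (simp add: L_def V.scale_sum_right)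
  have M_scale: "M (\<lambda>j. c * f j) = s2 c (M f)" for c f
    by (simp add: M_def W.scale_sum_right)
  have L_span: "module.span s1 (v ` J) = range L"
    unfolding L_def using \<open>finite J\<close> by (rule V.span_image_eq_linear_combinations)
  have M_span: "module.span s2 (u ` J) = range M"
    unfolding M_def using \<open>finite J\<close> by (rule W.span_image_eq_linear_combinations)
  have well_defined: "M f = M g" if "L f = L g" for f g
  proof -
    \<comment> \<open>The difference of the coefficient functions, written so that
      \<open>L_add\<close> and \<open>L_scale\<close> apply. A vanishing \<open>L h\<close> forces
      \<open>M h\<close> to have norm 0 by \<open>ip\<close>.\<close>
    define h where "h = (\<lambda>j. f j + (-1) * g j)"
    have "L h = 0"
      unfolding h_def L_add L_scale using that by (simp add: V.scale_minus_left)
    then have "M h = 0"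
      using ip[of h] by (simp add: W.ip_self_eq_0_iff)
    then show ?thesis
      unfolding h_def M_add M_scale by (simp add: W.scale_minus_left)
  qed
  \<comment> \<open>Any coefficients representing \<open>x\<close> may be chosen, by
    \<open>well_defined\<close>. Outside the range of \<open>L\<close> the value is
    arbitrary.\<close>
  define U where "U x = M (SOME f. L f = x)" for x
  have U: "U (L f) = M f" for f
    unfolding U_def by (rule well_defined, rule someI[of "\<lambda>g. L g = L f"]) (rule refl)
  show thesis
  proof (rule that)
    show "unitary_map s1 ip1 (module.span s1 (v ` J)) s2 ip2 (module.span s2 (u ` J)) U"
      unfolding unitary_map_def L_span M_span
      by (auto simp: U ip ip_norm_def image_image simp flip: L_add M_add L_scale M_scale)
    fix i assume i: "i \<in> J"
    have "L (\<lambda>j. if j = i then 1 else 0) = (\<Sum>j\<in>J. if j = i then v j else 0)"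
      unfolding L_def by (rule sum.cong) auto
    moreover have "M (\<lambda>j. if j = i then 1 else 0) = (\<Sum>j\<in>J. if j = i then u j else 0)"
      unfolding M_def by (rule sum.cong) auto
    ultimately show "U (v i) = u i"
      using U[of "\<lambda>j. if j = i then 1 else 0"] i \<open>finite J\<close> by simp
  qed
qed

text \<open>Multiplying each \<open>w j\<close> by \<open>cnj (c j)\<close> undoes the phases in the
  Gram matrix and, as the factors are unimodular, leaves the span unchanged.\<close>

lemma proj_unitarily_equivalent_of_gram:
  assumes "complex_inner_space s1 ip1" and "complex_inner_space s2 ip2" and "finite J"
    and unit: "\<And>j. j \<in> J \<Longrightarrow> cmod (c j) = 1"
    and gram: "\<And>j l. j \<in> J \<Longrightarrow> l \<in> J \<Longrightarrow> ip2 (w j) (w l) = c j * cnj (c l) * ip1 (v j) (v l)"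
  shows "proj_unitarily_equivalent s1 ip1 s2 ip2 J v w"
proof -
  interpret W: complex_inner_space s2 ip2 by fact
  define u where "u j = s2 (cnj (c j)) (w j)" for j
  have c_cnj: "c j * cnj (c j) = 1" if "j \<in> J" for j
    using unit[OF that] by (metis complex_norm_square of_real_1 power_one)
  have w: "w j = s2 (c j) (u j)" if "j \<in> J" for j
    using c_cnj[OF that] by (simp add: u_def)
  have "ip2 (u j) (u l) = ip1 (v j) (v l)" if "j \<in> J" "l \<in> J" for j l
  proof -
    have "ip2 (u j) (u l) = (c j * cnj (c j)) * (c l * cnj (c l)) * ip1 (v j) (v l)"
      by (simp add: u_def W.ip_scale_left W.ip_scale_right gram that)
    then show ?thesis
      using c_cnj that by simp
  qed
  then obtain U
    where U: "unitary_map s1 ip1 (module.span s1 (v ` J)) s2 ip2 (module.span s2 (u ` J)) U"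
      and Uv: "\<And>j. j \<in> J \<Longrightarrow> U (v j) = u j"
    using unitary_map_of_gram_eq[of s1 ip1 s2 ip2 J u v] assms(1-3) by metis
  have "W.span (u ` J) = W.span (w ` J)"
  proof (rule antisym)
    show "W.span (u ` J) \<subseteq> W.span (w ` J)"
      by (rule W.span_minimal) (auto simp: u_def intro!: W.span_scale intro: W.span_base)
    show "W.span (w ` J) \<subseteq> W.span (u ` J)"
      by (rule W.span_minimal) (auto simp: w intro!: W.span_scale intro: W.span_base)
  qed
  then show ?thesis
    unfolding proj_unitarily_equivalent_def using U Uv w unit by metis
qed

text \<open>Here \<open>p\<close> assigns to each vertex its part. A potential \<open>c\<close> is
  read off along a spanning tree; the triangle condition replaces an edge by a path of two edges
  through another part. The vertices \<open>a\<close>, \<open>b\<close>, \<open>e\<close> in three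
  different parts supply the intermediate points.\<close>

lemma multipartite_phases_coboundary:
  fixes M :: "'j \<Rightarrow> 'j \<Rightarrow> complex" and p :: "'j \<Rightarrow> 'p"
  assumes base: "a \<in> J" "b \<in> J" "e \<in> J" "p a \<noteq> p b" "p a \<noteq> p e" "p b \<noteq> p e"
    and unit: "\<And>j l. j \<in> J \<Longrightarrow> l \<in> J \<Longrightarrow> p j \<noteq> p l \<Longrightarrow> cmod (M j l) = 1"
    and herm: "\<And>j l. j \<in> J \<Longrightarrow> l \<in> J \<Longrightarrow> p j \<noteq> p l \<Longrightarrow> M l j = cnj (M j l)"
    and triangle: "\<And>j m l. j \<in> J \<Longrightarrow> m \<in> J \<Longrightarrow> l \<in> J \<Longrightarrow>
      p j \<noteq> p m \<Longrightarrow> p m \<noteq> p l \<Longrightarrow> p l \<noteq> p j \<Longrightarrow> M j m * M m l * M l j = 1"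
  obtains c where "\<And>j. j \<in> J \<Longrightarrow> cmod (c j) = 1"
    and "\<And>j l. j \<in> J \<Longrightarrow> l \<in> J \<Longrightarrow> p j \<noteq> p l \<Longrightarrow> M j l = c j * cnj (c l)"
proof -
  have inv: "M j l * M l j = 1" if "j \<in> J" "l \<in> J" "p j \<noteq> p l" for j l
    using unit[OF that] herm[OF that] by (metis complex_norm_square of_real_1 power_one)
  have path: "M j l = M j m * M m l"
    if "j \<in> J" "m \<in> J" "l \<in> J" "p j \<noteq> p m" "p m \<noteq> p l" "p l \<noteq> p j" for j m l
  proof -
    have "M j l = (M j m * M m l * M l j) * M j l"
      using triangle[OF that] by simp
    also have "\<dots> = M j m * M m l * (M l j * M j l)"
      by (simp only: mult.assoc)
    also have "\<dots> = M j m * M m l"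
      using inv[of l j] that by simp
    finally show ?thesis .
  qed
  (* Phases along the spanning tree that joins a to all vertices outside its part,
     and b to all vertices inside the part of a. *)
  define c where "c j = (if p j = p a then M j b * M b a else M j a)" for j
  have c_unit: "cmod (c j) = 1" if "j \<in> J" for j
    using that base unit by (auto simp: c_def norm_mult)
  have c_cnj: "cnj (c j) * c j = 1" if "j \<in> J" for j
    using c_unit[OF that] by (metis complex_norm_square of_real_1 power_one mult.commute)
  \<comment> \<open>Both endpoints are joined to \<open>a\<close> in the tree, so the triangle
    through \<open>a\<close> suffices.\<close>
  have outside: "M j l = c j * cnj (c l)"
    if "j \<in> J" "l \<in> J" "p j \<noteq> p l" "p j \<noteq> p a" "p l \<noteq> p a" for j l
    using path[of j a l] herm[of l a] that base by (auto simp: c_def)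
  \<comment> \<open>The tree path from \<open>j\<close> to \<open>l\<close> is \<open>j\<close>,
    \<open>b\<close>, \<open>a\<close>, \<open>l\<close>; the triangles on \<open>j\<close>,
    \<open>b\<close>, \<open>l\<close> and on \<open>b\<close>, \<open>a\<close>, \<open>l\<close>
    contract it to a single edge.\<close>
  have off_b: "M j l = c j * cnj (c l)"
    if "j \<in> J" "l \<in> J" "p j = p a" "p l \<noteq> p a" "p l \<noteq> p b" for j l
    using path[of j b l] path[of b a l] herm[of l a] that base by (auto simp: c_def)
  have inside: "M j l = c j * cnj (c l)"
    if "j \<in> J" "l \<in> J" "p j = p a" "p l \<noteq> p a" for j l
  proof (cases "p l = p b")
    case True
    \<comment> \<open>Now \<open>l\<close> lies in the part of \<open>b\<close>, so no triangle
      contains \<open>j\<close>, \<open>b\<close> and \<open>l\<close>. The detour through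
      \<open>e\<close> in a third part reduces the edge to two cases already settled.\<close>
    have "M j l = M j e * M e l"
      using path[of j e l] that base True by auto
    also have "\<dots> = (c j * cnj (c e)) * (c e * cnj (c l))"
      using off_b[of j e] outside[of e l] that base True by auto
    also have "\<dots> = c j * (cnj (c e) * c e) * cnj (c l)"
      by (simp only: mult.assoc)
    finally show ?thesis
      using c_cnj base by simp
  qed (use off_b that in auto)
  have "M j l = c j * cnj (c l)" if jl: "j \<in> J" "l \<in> J" "p j \<noteq> p l" for j l
  proof (cases "p l = p a")
    case True
    then have "M l j = c l * cnj (c j)"
      using inside jl by auto
    then show ?thesis
      using herm[of l j] jl by (simp add: mult.commute)
  qed (use inside outside jl in blast)
  with c_unit show thesis
    by (rule that)
qed

text \<open>The 3-products with repeated indices carry the moduli: the indices \<open>j\<close>,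
  \<open>j\<close>, \<open>j\<close> determine the norm of the vector, and \<open>j\<close>,
  \<open>j\<close>, \<open>l\<close> then determine the modulus of the inner product.\<close>

lemma gram_modulus_of_triple_products:
  assumes "complex_inner_space s1 ip1" and "complex_inner_space s2 ip2"
    and "j \<in> J" and "l \<in> J"
    and tp: "\<And>j m l. j \<in> J \<Longrightarrow> m \<in> J \<Longrightarrow> l \<in> J \<Longrightarrow>
      triple_product ip1 v j m l = triple_product ip2 w j m l"
  shows "ip2 (w j) (w j) = ip1 (v j) (v j)"
    and "cmod (ip2 (w j) (w l)) = cmod (ip1 (v j) (v l))"
proof -
  interpret V: complex_inner_space s1 ip1 by fact
  interpret W: complex_inner_space s2 ip2 by fact
  \<comment> \<open>Both sides are cubes of squared norms, and cubing is injective on the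
    nonnegative reals.\<close>
  have "(complex_of_real (Re (ip1 (v j) (v j)))) ^ 3 = (complex_of_real (Re (ip2 (w j) (w j)))) ^ 3"
    using tp[of j j j] \<open>j \<in> J\<close>
    by (simp add: triple_product_def power3_eq_cube flip: V.ip_self_real W.ip_self_real)
  then have "Re (ip1 (v j) (v j)) ^ 3 = Re (ip2 (w j) (w j)) ^ 3"
    by (simp only: of_real_eq_iff flip: of_real_power)
  then have "Re (ip1 (v j) (v j)) = Re (ip2 (w j) (w j))"
    by (rule power_eq_imp_eq_base) (simp_all add: V.ip_self_nonneg W.ip_self_nonneg)
  then show self: "ip2 (w j) (w j) = ip1 (v j) (v j)"
    by (metis V.ip_self_real W.ip_self_real)
  \<comment> \<open>The squared norm can be cancelled from the 3-product only if \<open>v j\<close>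
    is nonzero; otherwise \<open>w j\<close> vanishes as well, because the norms agree.\<close>
  show "cmod (ip2 (w j) (w l)) = cmod (ip1 (v j) (v l))"
  proof (cases "v j = 0")
    case True
    then have "w j = 0"
      using self by (simp add: W.ip_self_eq_0_iff)
    with True show ?thesis by simp
  next
    case False
    have "ip1 (v j) (v j) * (ip1 (v j) (v l) * ip1 (v l) (v j)) =
          ip1 (v j) (v j) * (ip2 (w j) (w l) * ip2 (w l) (w j))"
      using tp[of j j l] \<open>j \<in> J\<close> \<open>l \<in> J\<close> by (simp add: triple_product_def self mult.assoc)
    then have "ip1 (v j) (v l) * ip1 (v l) (v j) = ip2 (w j) (w l) * ip2 (w l) (w j)"
      using False by (simp add: V.ip_self_eq_0_iff)
    then have "(cmod (ip1 (v j) (v l)))\<^sup>2 = (cmod (ip2 (w j) (w l)))\<^sup>2"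
      by (simp only: V.ip_mult_commuted W.ip_mult_commuted of_real_eq_iff)
    then show ?thesis
      by simp
  qed
qed

text \<open>The general setting is a family whose nonzero inner products between distinct members
  form a complete multipartite graph with at least three parts. Moduli come from 3-products with
  repeated indices, phases from the triangles.\<close>

theorem proj_unitarily_equivalent_multipartite:
  assumes "complex_inner_space s1 ip1" and "complex_inner_space s2 ip2" and "finite J"
    and base: "a \<in> J" "b \<in> J" "e \<in> J" "p a \<noteq> p b" "p a \<noteq> p e" "p b \<noteq> p e"
    and orth: "\<And>j l. j \<in> J \<Longrightarrow> l \<in> J \<Longrightarrow> p j = p l \<Longrightarrow> j \<noteq> l \<Longrightarrow> ip1 (v j) (v l) = 0"
    and nz: "\<And>j l. j \<in> J \<Longrightarrow> l \<in> J \<Longrightarrow> p j \<noteq> p l \<Longrightarrow> ip1 (v j) (v l) \<noteq> 0"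
    and tp: "\<And>j m l. j \<in> J \<Longrightarrow> m \<in> J \<Longrightarrow> l \<in> J \<Longrightarrow>
      triple_product ip1 v j m l = triple_product ip2 w j m l"
  shows "proj_unitarily_equivalent s1 ip1 s2 ip2 J v w"
proof -
  interpret V: complex_inner_space s1 ip1 by fact
  interpret W: complex_inner_space s2 ip2 by fact
  note modulus = gram_modulus_of_triple_products[OF assms(1,2) _ _ tp]
  \<comment> \<open>The relative phase; it is meaningful between different parts, where the
    denominator is nonzero.\<close>
  define M where "M j l = ip2 (w j) (w l) / ip1 (v j) (v l)" for j l
  have nz': "ip2 (w j) (w l) \<noteq> 0" if "j \<in> J" "l \<in> J" "p j \<noteq> p l" for j l
    using modulus(2)[OF that(1,2)] nz[OF that] by (metis norm_eq_zero)
  have M_unit: "cmod (M j l) = 1" if "j \<in> J" "l \<in> J" "p j \<noteq> p l" for j l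
    using modulus(2)[OF that(1,2)] nz[OF that] by (simp add: M_def norm_divide)
  have M_herm: "M l j = cnj (M j l)" for j l
    unfolding M_def complex_cnj_divide by (metis V.ip_cnj_commute W.ip_cnj_commute)
  have M_triangle: "M j m * M m l * M l j = 1"
    if "j \<in> J" "m \<in> J" "l \<in> J" "p j \<noteq> p m" "p m \<noteq> p l" "p l \<noteq> p j" for j m l
    using tp[OF that(1-3)] nz' that by (simp add: M_def triple_product_def)
  obtain c where unit: "\<And>j. j \<in> J \<Longrightarrow> cmod (c j) = 1"
    and c: "\<And>j l. j \<in> J \<Longrightarrow> l \<in> J \<Longrightarrow> p j \<noteq> p l \<Longrightarrow> M j l = c j * cnj (c l)"
    using multipartite_phases_coboundary[where M = M and p = p, OF base M_unit M_herm M_triangle]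
    by blast
  show ?thesis
  proof (rule proj_unitarily_equivalent_of_gram[where c = c])
    fix j l assume jl: "j \<in> J" "l \<in> J"
    consider "j = l" | "j \<noteq> l" "p j = p l" | "p j \<noteq> p l" by blast
    then show "ip2 (w j) (w l) = c j * cnj (c l) * ip1 (v j) (v l)"
    proof cases
      case 1
      have "c j * cnj (c j) = 1"
        using unit[OF jl(1)] by (metis complex_norm_square of_real_1 power_one)
      then show ?thesis
        using modulus(1)[OF jl] 1 by simp
    next
      \<comment> \<open>Inside a part the entry for \<open>v\<close> is 0, and equality of moduli
        carries this over to \<open>w\<close>.\<close>
      case 2
      then show ?thesis
        using modulus(2)[OF jl] orth[OF jl] by simp
    next
      case 3
      then show ?thesis
        using c[OF jl] nz[OF jl] by (simp add: M_def field_simps)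
    qed
  qed (use assms(1-3) unit in auto)
qed

theorem theorem4p7:
  fixes k :: nat
    and B :: "nat \<Rightarrow> nat \<Rightarrow> complex ^ 'd"
    and J :: "(nat \<times> nat) set"
    and v :: "nat \<times> nat \<Rightarrow> complex ^ 'd"
    and scale :: "complex \<Rightarrow> 'b::ab_group_add \<Rightarrow> 'b"
    and ip :: "'b \<Rightarrow> 'b \<Rightarrow> complex"
    and w :: "nat \<times> nat \<Rightarrow> 'b"
  defines "J \<equiv> {1..k} \<times> {1..CARD('d)}"
    and "v \<equiv> (\<lambda>(r, i). B r i)"
  assumes "k \<ge> 3"
    and "mutually_unbiased_bases k B"
    and "complex_inner_space scale ip"
    and "\<forall>j\<in>J. \<forall>m\<in>J. \<forall>l\<in>J. triple_product cinner v j m l = triple_product ip w j m l"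
  shows "proj_unitarily_equivalent vector_scalar_mult cinner scale ip J v w"
proof -
  have orthonormal: "cinner (B r i) (B r j) = (if i = j then 1 else 0)"
    if "r \<in> {1..k}" "i \<in> {1..CARD('d)}" "j \<in> {1..CARD('d)}" for r i j
    using assms(4) that unfolding mutually_unbiased_bases_def orthonormal_basis_def by blast
  have unbiased: "(cmod (cinner (B r i) (B s j)))\<^sup>2 = 1 / real CARD('d)"
    if "r \<in> {1..k}" "s \<in> {1..k}" "r \<noteq> s" "i \<in> {1..CARD('d)}" "j \<in> {1..CARD('d)}" for r s i j
    using assms(4) that unfolding mutually_unbiased_bases_def by blast
  show ?thesis
  \<comment> \<open>The parts are the bases, and the first vectors of three of them serve as base
    points. Inner products across bases are nonzero since their squared modulus is
    \<open>1 / real CARD('d)\<close>.\<close>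
  proof (rule proj_unitarily_equivalent_multipartite
      [OF complex_inner_space_cinner assms(5), where p = fst and a = "(1, 1)" and b = "(2, 1)" and e = "(3, 1)"])
    show "finite J" "(1, 1) \<in> J" "(2, 1) \<in> J" "(3, 1) \<in> J"
      using \<open>k \<ge> 3\<close> by (auto simp: J_def Suc_le_eq)
    show "cinner (v j) (v l) = 0" if "j \<in> J" "l \<in> J" "fst j = fst l" "j \<noteq> l" for j l
      using that orthonormal[of "fst j" "snd j" "snd l"]
      by (auto simp: J_def v_def case_prod_beta prod_eq_iff)
    show "cinner (v j) (v l) \<noteq> 0" if "j \<in> J" "l \<in> J" "fst j \<noteq> fst l" for j l
      using that unbiased[of "fst j" "fst l" "snd j" "snd l"]
      by (auto simp: J_def v_def case_prod_beta)
  qed (use assms(6) in auto)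
qed

end
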